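(* (Two-touch case.) Let $F:\mathbb{R}^3\setminus\{\mathbf 0\}\to\mathbb{C}$ and $s:\mathbb{R}\setminus\{0\}\to\mathbb{C}$ satisfy $F(\alpha\mathbf r)=s(\alpha)F(\mathbf r)$ for all $\alpha\in\mathbb{R}\setminus\{0\}$ and $\mathbf r\neq\mathbf 0$. Let $\mathrm S$ be a triangle in $\mathbb{R}^3$ with vertices $\mathbf p_1,\mathbf p_2,\mathbf p_3$ and $\mathrm R$ a triangle in $\mathbb{R}^3$ with vertices $\mathbf q_1,\mathbf q_2,\mathbf q_3$, meeting exactly in a common edge, with $\mathbf p_2=\mathbf q_3$, $\mathbf p_3=\mathbf q_2$, and $\mathbf p_2+\mathbf p_3=\mathbf 0$. Assume that $(\mathbf x,\mathbf x')\mapsto F(\mathbf x-\mathbf x')$ is absolutely integrable over $\mathrm R\times\mathrm S$, and let $\mathbf p,\mathbf p'\in\mathbb{R}^3$. Let $1',2',3',4'$ and $1,2,3,4$ be the midpoint subdivisions of $\mathrm S$ and $\mathrm R$, and for each superscript $\bullet\in\{1,\mathbf p',\mathbf p,\mathbf p'\mathbf p\}$ put $I^\bullet=I^\bullet_{\mathrm S\mathrm R}$ and $$I^\bullet_{\mathrm{remainder}}=I^\bullet_{1'\mathrm R}+I^\bullet_{2'2}+I^\bullet_{2'4}+I^\bullet_{3'3}+I^\bullet_{3'4}+I^\bullet_{4'2}+I^\bullet_{4'3}+I^\bullet_{4'4}+I^\bullet_{\mathrm S1}-I^\bullet_{1'1}.$$ Then each of the following identities holds whenever the quantity inverted in it is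 nonzero: $$I^1=\left(1-\tfrac18s\left(\tfrac12\right)\right)^{-1}I^1_{\mathrm{remainder}},$$ $$I^{\mathbf p'}=\left(1-\tfrac1{16}s\left(\tfrac12\right)\right)^{-1}I^{\mathbf p'}_{\mathrm{remainder}},$$ $$I^{\mathbf p}=\left(1-\tfrac1{16}s\left(\tfrac12\right)\right)^{-1}I^{\mathbf p}_{\mathrm{remainder}},$$ $$I^{\mathbf p'\mathbf p}=\left(1-\tfrac1{32}s\left(\tfrac12\right)\right)^{-1}\left(I^{\mathbf p'\mathbf p}_{\mathrm{remainder}}+a^{\mathbf p'\mathbf p}\right),$$ where $$a^{\mathbf p'\mathbf p}=\tfrac1{64}s\left(\tfrac12\right)\left((\mathbf p\cdot\mathbf p_2)(\mathbf p'\cdot\mathbf p_2)+(\mathbf p\cdot\mathbf p_3)(\mathbf p'\cdot\mathbf p_3)\right)I^1.$$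
   Context: Triangles are closed and nondegenerate. For triangles $A,B\subset\mathbb{R}^3$ (source $A$, receiver $B$), with $dS$ denoting surface (area) measure, define $$I^1_{AB}=\int_{\mathbf x\in B}\int_{\mathbf x'\in A}F(\mathbf x-\mathbf x')\,dS(\mathbf x')\,dS(\mathbf x),$$ $$I^{\mathbf p'}_{AB}=\int_{\mathbf x\in B}\int_{\mathbf x'\in A}(\mathbf p'\cdot\mathbf x')F(\mathbf x-\mathbf x')\,dS(\mathbf x')\,dS(\mathbf x),$$ $$I^{\mathbf p}_{AB}=\int_{\mathbf x\in B}\int_{\mathbf x'\in A}(\mathbf p\cdot\mathbf x)F(\mathbf x-\mathbf x')\,dS(\mathbf x')\,dS(\mathbf x),$$ $$I^{\mathbf p'\mathbf p}_{AB}=\int_{\mathbf x\in B}\int_{\mathbf x'\in A}(\mathbf p'\cdot\mathbf x')(\mathbf p\cdot\mathbf x)F(\mathbf x-\mathbf x')\,dS(\mathbf x')\,dS(\mathbf x).$$ Midpoint subdivision: joining the midpoints of its edges divides $\mathrm S$ into four congruent triangles; for $i=1,2,3$, $i'$ is the one containing the vertex $\mathbf p_i$ (its vertices are $\mathbf p_i$ and the midpoints of the two edges of $\mathrm S$ at $\mathbf p_i$), and $4'$ is the central one, whose vertices are the three edge midpoints. Likewise $\mathrm R$ is divided into $1,2,3$ (triangle $i$ containing $\mathbf q_i$) and the central triangle $4$. A subscript such as $1'\mathrm R$ means $A=1'$, $B=\mathrm R$; $\mathrm S1$ means $A=\mathrm S$, $B=1$. *)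

theory Defs
  imports "HOL-Analysis.Analysis"
begin

text \<open>A triangle is given by the triple of its vertices.\<close>

type_synonym triangle = "(real^3) \<times> (real^3) \<times> (real^3)"

fun tri_set :: "triangle \<Rightarrow> (real^3) set" where
  "tri_set (a, b, c) = convex hull {a, b, c}"

fun nondegenerate :: "triangle \<Rightarrow> bool" where
  "nondegenerate (a, b, c) \<longleftrightarrow> \<not> collinear {a, b, c}"

definition ref_triangle :: "(real \<times> real) set" where
  "ref_triangle = {(u, v). 0 \<le> u \<and> 0 \<le> v \<and> u + v \<le> 1}"

fun tri_param :: "triangle \<Rightarrow> real \<times> real \<Rightarrow> real^3" where
  "tri_param (a, b, c) (u, v) = a + u *\<^sub>R (b - a) + v *\<^sub>R (c - a)"

text \<open>The area element of \<open>tri_param (a, b, c)\<close> is the constant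
  \<open>norm (cross3 (b - a) (c - a))\<close>, so the surface measure is this multiple of the image of planar
  Lebesgue measure on the reference triangle. It is a measure on all Borel sets of the ambient
  space, concentrated on \<open>tri_set (a, b, c)\<close>, and does not depend on the order of the vertices.\<close>

fun surface_measure :: "triangle \<Rightarrow> (real^3) measure" where
  "surface_measure (a, b, c) =
     scale_measure (ennreal (norm (cross3 (b - a) (c - a))))
       (distr (restrict_space lborel ref_triangle) borel (tri_param (a, b, c)))"

text \<open>The first triangle is the source \<open>A\<close> (inner variable \<open>x'\<close>), the second one the
  receiver \<open>B\<close> (outer variable \<open>x\<close>). Completions are taken so that Lebesgue measurable, and not
  only Borel measurable, integrands are admitted.\<close>

definition tri_integral ::
    "(real^3 \<Rightarrow> real^3 \<Rightarrow> complex) \<Rightarrow> triangle \<Rightarrow> triangle \<Rightarrow> complex" where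
  "tri_integral K A B =
     (LINT x|completion (surface_measure B). LINT x'|completion (surface_measure A). K x x')"

definition abs_integrable_over ::
    "(real^3 \<Rightarrow> real^3 \<Rightarrow> complex) \<Rightarrow> triangle \<Rightarrow> triangle \<Rightarrow> bool" where
  "abs_integrable_over K A B \<longleftrightarrow>
     integrable (completion (surface_measure B \<Otimes>\<^sub>M surface_measure A)) (\<lambda>(x, x'). K x x')"

definition I_one :: "(real^3 \<Rightarrow> complex) \<Rightarrow> triangle \<Rightarrow> triangle \<Rightarrow> complex" where
  "I_one F A B = tri_integral (\<lambda>x x'. F (x - x')) A B"

definition I_src :: "(real^3 \<Rightarrow> complex) \<Rightarrow> real^3 \<Rightarrow> triangle \<Rightarrow> triangle \<Rightarrow> complex" where
  "I_src F p' A B = tri_integral (\<lambda>x x'. of_real (p' \<bullet> x') * F (x - x')) A B"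

definition I_rcv :: "(real^3 \<Rightarrow> complex) \<Rightarrow> real^3 \<Rightarrow> triangle \<Rightarrow> triangle \<Rightarrow> complex" where
  "I_rcv F p A B = tri_integral (\<lambda>x x'. of_real (p \<bullet> x) * F (x - x')) A B"

definition I_both ::
    "(real^3 \<Rightarrow> complex) \<Rightarrow> real^3 \<Rightarrow> real^3 \<Rightarrow> triangle \<Rightarrow> triangle \<Rightarrow> complex" where
  "I_both F p' p A B =
     tri_integral (\<lambda>x x'. of_real (p' \<bullet> x') * of_real (p \<bullet> x) * F (x - x')) A B"

fun sub1 :: "triangle \<Rightarrow> triangle" where
  "sub1 (a, b, c) = (a, midpoint a b, midpoint a c)"

fun sub2 :: "triangle \<Rightarrow> triangle" where
  "sub2 (a, b, c) = (b, midpoint a b, midpoint b c)"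

fun sub3 :: "triangle \<Rightarrow> triangle" where
  "sub3 (a, b, c) = (c, midpoint a c, midpoint b c)"

fun sub4 :: "triangle \<Rightarrow> triangle" where
  "sub4 (a, b, c) = (midpoint a b, midpoint b c, midpoint a c)"

definition two_touch_remainder ::
    "(triangle \<Rightarrow> triangle \<Rightarrow> complex) \<Rightarrow> triangle \<Rightarrow> triangle \<Rightarrow> complex" where
  "two_touch_remainder I S R =
     I (sub1 S) R
     + I (sub2 S) (sub2 R) + I (sub2 S) (sub4 R)
     + I (sub3 S) (sub3 R) + I (sub3 S) (sub4 R)
     + I (sub4 S) (sub2 R) + I (sub4 S) (sub3 R) + I (sub4 S) (sub4 R)
     + I S (sub1 R) - I (sub1 S) (sub1 R)"

end

theory Submission
  imports Defs
begin

text \<open>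
  Splitting the two triangles gives sixteen pairs of subtriangles. All of them occur in the remainder
  except the two pairs \<open>(2', 3)\<close> and \<open>(3', 2)\<close>, each of which is the image of the pair \<open>(S, R)\<close> under
  the homothety of ratio \<open>1/2\<close> centred at a common vertex. Their contribution is therefore
  \<open>1/16 * s (1/2)\<close> times the integral over \<open>(S, R)\<close> with each point \<open>x\<close> replaced by \<open>(x + c) / 2\<close>
  in the linear factors; since the two centres \<open>c\<close> are opposite, the terms of odd degree in \<open>c\<close>
  cancel in the sum.
\<close>

text \<open>The factor 1/16 is an area effect: halving lengths divides each of the two area elements
  by 4. One homothety acts on both members of a pair because the corners share the vertex
  \<open>p2 = q3\<close> or \<open>p3 = q2\<close>; differences \<open>x - x'\<close> are then
  exactly halved, and homogeneity of \<open>F\<close> applies without any translation. Integrability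
  is assumed for the completed product measure, while the integrals are iterated ones over completed
  factors, so a kernel has to be replaced by a Borel representative before Fubini, a change of
  variables or an additivity argument can be applied. For this reason the geometry is expressed
  through the measures: subdivision and homothety are identities between nonnegative integrals of
  Borel functions, free of integrability conditions, and are carried over to complex kernels
  afterwards. The four superscripts are handled together through the kernel \<open>(\<alpha> + p'
  \<bullet> x') * (\<beta> + p \<bullet> x) * F (x - x')\<close>, a family that is preserved, up to
  linear combination, by the contraction towards a vertex.\<close>

section \<open>Integrals over completed measures\<close>

text \<open>Measurability of \<open>f\<close> comes for free: its preimages differ from those of the
  Borel function \<open>g\<close> by null sets, and these are absorbed by the completion.\<close>

lemma completion_cong_AE:
  fixes f g :: "'a \<Rightarrow> 'b::{banach, second_countable_topology}"
  assumes g: "g \<in> borel_measurable M" and ae: "AE x in M. f x = g x"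
  shows integral_completion_cong_AE: "integral\<^sup>L (completion M) f = integral\<^sup>L M g"
    and integrable_completion_cong_AE: "integrable (completion M) f \<longleftrightarrow> integrable M g"
proof -
  have ae': "AE x in completion M. f x = g x"
    using ae by (rule AE_completion)
  have g': "g \<in> borel_measurable (completion M)"
    using g by (rule measurable_completion)
  have f: "f \<in> borel_measurable (completion M)"
  proof (rule measurableI)
    fix A :: "'b set" assume A: "A \<in> sets borel"
    show "f -` A \<inter> space (completion M) \<in> sets (completion M)"
    proof (rule completion.in_sets_AE)
      show "g -` A \<inter> space (completion M) \<in> sets (completion M)"
        using g' A by (rule measurable_sets)
      show "AE x in completion M. (x \<in> g -` A \<inter> space (completion M)) =
              (x \<in> f -` A \<inter> space (completion M))"
        using ae' by eventually_elim auto
    qed auto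
  qed auto
  show "integral\<^sup>L (completion M) f = integral\<^sup>L M g"
    using integral_cong_AE[OF f g' ae'] integral_completion[OF g] by simp
  show "integrable (completion M) f \<longleftrightarrow> integrable M g"
    using integrable_cong_AE[OF f g' ae'] integrable_completion[OF g] by simp
qed

text \<open>The source of all Borel representatives below; the real and imaginary parts are replaced
  separately.\<close>

lemma integrable_completion_ex:
  fixes f :: "'a \<Rightarrow> complex"
  assumes f: "integrable (completion M) f"
  obtains g where "integrable M g" and "AE x in M. f x = g x"
proof -
  have "(\<lambda>x. Re (f x)) \<in> borel_measurable (completion M)"
    and "(\<lambda>x. Im (f x)) \<in> borel_measurable (completion M)"
    using borel_measurable_integrable[OF f] by measurable
  from this[THEN completion_ex_borel_measurable_real] obtain u v
    where [measurable]: "u \<in> borel_measurable M" "v \<in> borel_measurable M"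
      and ae: "AE x in M. Re (f x) = u x" "AE x in M. Im (f x) = v x"
    by auto
  define g where "g = (\<lambda>x. of_real (u x) + \<i> * of_real (v x))"
  have g: "g \<in> borel_measurable M" unfolding g_def by measurable
  have eq: "AE x in M. f x = g x"
    using ae by eventually_elim (auto simp: g_def complex_eq_iff)
  show thesis
    using that eq f integrable_completion_cong_AE[OF g eq] by blast
qed

text \<open>Additivity on sets extends to indicators, then to linear combinations and dominated
  limits. Integrability is inherited since every summand \<open>N i\<close> lies below
  \<open>M\<close>.\<close>

lemma integral_sum_measure:
  fixes f :: "'a \<Rightarrow> 'b::{banach, second_countable_topology}"
  assumes I: "finite I" and sets: "\<And>i. i \<in> I \<Longrightarrow> sets (N i) = sets M"
    and em: "\<And>A. A \<in> sets M \<Longrightarrow> emeasure M A = (\<Sum>i\<in>I. emeasure (N i) A)"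
    and f: "integrable M f"
  shows "(\<forall>i\<in>I. integrable (N i) f) \<and> integral\<^sup>L M f = (\<Sum>i\<in>I. integral\<^sup>L (N i) f)"
proof -
  have int: "integrable (N i) h" if i: "i \<in> I" and h: "integrable M h"
    for i and h :: "'a \<Rightarrow> 'b"
  proof -
    have "N i \<le> M"
      using I i by (subst le_measure) (auto simp: sets em intro!: member_le_sum)
    then have "(\<integral>\<^sup>+x. norm (h x) \<partial>N i) \<le> (\<integral>\<^sup>+x. norm (h x) \<partial>M)"
      using sets[OF i] by (intro nn_integral_mono_measure) auto
    with h sets[OF i] show ?thesis
      by (auto simp: integrable_iff_bounded cong: measurable_cong_sets intro: le_less_trans)
  qed
  \<comment> \<open>Finiteness has to be secured before passing to the real-valued
    \<open>measure\<close>, which would send infinity to 0.\<close>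
  have fin: "emeasure (N i) A < \<infinity>"
    if "i \<in> I" "A \<in> sets M" "emeasure M A < \<infinity>" for i A
    using that em[OF that(2)] I member_le_sum[of i I "\<lambda>i. emeasure (N i) A"]
    by (auto intro: le_less_trans)
  have "integral\<^sup>L M f = (\<Sum>i\<in>I. integral\<^sup>L (N i) f)"
    using f
  proof (induction rule: integrable_induct)
    case (base A c)
    have "measure M A = (\<Sum>i\<in>I. measure (N i) A)"
      using fin[OF _ base] em[OF base(1)] base(2) I
      by (simp add: measure_def enn2real_sum)
    moreover have "integral\<^sup>L (N i) (\<lambda>x. indicator A x *\<^sub>R c) = measure (N i) A *\<^sub>R c"
      if "i \<in> I" for i
      using fin[OF that base] sets[OF that] base(1) by simp
    ultimately show ?case
      using base by (simp add: scaleR_sum_left)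
  next
    case (add f g)
    then show ?case by (simp add: int sum.distrib)
  next
    case (lim f s)
    have "(\<lambda>k. integral\<^sup>L M (s k)) \<longlonglongrightarrow> integral\<^sup>L M f"
      by (rule integral_dominated_convergence[where w="\<lambda>x. 2 * norm (f x)"])
         (use lim in \<open>auto\<close>)
    moreover have "(\<lambda>k. integral\<^sup>L (N i) (s k)) \<longlonglongrightarrow> integral\<^sup>L (N i) f" if i: "i \<in> I" for i
      by (rule integral_dominated_convergence[where w="\<lambda>x. 2 * norm (f x)"])
         (use lim int[OF i] sets_eq_imp_space_eq[OF sets[OF i]] in \<open>auto\<close>)
    ultimately show ?case
      using lim(2) by (intro LIMSEQ_unique[of "\<lambda>k. integral\<^sup>L M (s k)"]) (auto simp: lim tendsto_sum)
  qed
  with int f show ?thesis by blast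
qed

text \<open>A null set of \<open>M\<close> is null for every \<open>N i\<close>, so a single Borel
  representative serves the whole and all its parts.\<close>

lemma integral_completion_sum_measure:
  fixes f :: "'a \<Rightarrow> complex"
  assumes I: "finite I" and sets: "\<And>i. i \<in> I \<Longrightarrow> sets (N i) = sets M"
    and em: "\<And>A. A \<in> sets M \<Longrightarrow> emeasure M A = (\<Sum>i\<in>I. emeasure (N i) A)"
    and f: "integrable (completion M) f"
  shows "(\<forall>i\<in>I. integrable (completion (N i)) f) \<and>
    integral\<^sup>L (completion M) f = (\<Sum>i\<in>I. integral\<^sup>L (completion (N i)) f)"
proof -
  obtain g where g: "integrable M g" and ae: "AE x in M. f x = g x"
    using integrable_completion_ex[OF f] .
  have ae': "AE x in N i. f x = g x" if i: "i \<in> I" for i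
  proof -
    obtain Z where Z: "Z \<in> null_sets M" "{x \<in> space M. \<not> f x = g x} \<subseteq> Z"
      using ae by (auto elim!: AE_E)
    have "Z \<in> null_sets (N i)"
      using Z em[of Z] I i sets[OF i] by (auto simp: null_sets_def)
    with Z sets_eq_imp_space_eq[OF sets[OF i]] show ?thesis
      by (intro AE_I'[of Z]) auto
  qed
  have gm: "g \<in> borel_measurable (N i)" if i: "i \<in> I" for i
    using g sets[OF i] by (auto cong: measurable_cong_sets)
  show ?thesis
    using integral_sum_measure[OF I sets em g] g integral_completion_cong_AE[OF _ ae]
      integral_completion_cong_AE[OF gm ae'] integrable_completion_cong_AE[OF gm ae']
    by auto
qed

lemma scale_measure_eq_density: "scale_measure r M = density M (\<lambda>_. r)"
  by (rule measure_eqI) (auto simp: emeasure_density nn_integral_cmult_indicator)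

text \<open>Since \<open>r\<close> is positive, scaling creates no new null sets, so almost
  everywhere equality can be pulled back along \<open>T\<close>; dividing by \<open>r\<close> then
  recovers integrability.\<close>

lemma integral_completion_scale_distr:
  fixes f :: "'b \<Rightarrow> complex"
  assumes T: "T \<in> measurable M N" and r: "0 < r"
    and f: "integrable (completion (scale_measure (ennreal r) (distr M N T))) f"
  shows "integrable (completion M) (f \<circ> T) \<and>
    integral\<^sup>L (completion (scale_measure (ennreal r) (distr M N T))) f =
      of_real r * integral\<^sup>L (completion M) (f \<circ> T)"
proof -
  let ?S = "scale_measure (ennreal r) (distr M N T)"
  obtain g where g: "integrable ?S g" and ae: "AE x in ?S. f x = g x"
    using integrable_completion_ex[OF f] .
  have gm: "g \<in> borel_measurable N"
    using borel_measurable_integrable[OF g] by simp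
  have gT: "g \<circ> T \<in> borel_measurable M"
    using measurable_comp[OF T gm] .
  have "AE x in distr M N T. f x = g x"
    using ae r unfolding scale_measure_eq_density by (subst (asm) AE_density) auto
  then have aeT: "AE x in M. (f \<circ> T) x = (g \<circ> T) x"
    using AE_distrD[OF T] by simp
  have "integral\<^sup>L ?S g = r *\<^sub>R integral\<^sup>L M (g \<circ> T)"
    unfolding scale_measure_eq_density using r gm T
    by (simp add: integral_density integral_distr comp_def)
  moreover have "integrable M (g \<circ> T)"
  proof -
    have "integrable M (\<lambda>x. r *\<^sub>R g (T x))"
      using g gm r T unfolding scale_measure_eq_density
      by (simp add: integrable_density integrable_distr_eq)
    from integrable_scaleR_right[OF this, of "1 / r"] r show ?thesis
      by (simp add: comp_def)
  qed
  ultimately show ?thesis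
    using integral_completion_cong_AE[OF borel_measurable_integrable[OF g] ae]
      integral_completion_cong_AE[OF gT aeT] integrable_completion_cong_AE[OF gT aeT]
    by (simp add: scaleR_conv_of_real comp_def)
qed

text \<open>Fubini across completions. For almost every \<open>x\<close> the section of
  \<open>K\<close> agrees almost everywhere with that of its Borel representative, so the inner
  integrals agree for almost every \<open>x\<close>, and the outer completion absorbs the
  exceptional points.\<close>

lemma integral_completion_pair:
  fixes K :: "'a \<Rightarrow> 'b \<Rightarrow> complex"
  assumes "sigma_finite_measure M" "sigma_finite_measure N"
    and K: "integrable (completion (M \<Otimes>\<^sub>M N)) (\<lambda>(x, y). K x y)"
  shows "(LINT x|completion M. LINT y|completion N. K x y) =
    integral\<^sup>L (completion (M \<Otimes>\<^sub>M N)) (\<lambda>(x, y). K x y)"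
proof -
  interpret N: sigma_finite_measure N by fact
  interpret M: sigma_finite_measure M by fact
  interpret pair_sigma_finite M N ..
  obtain g where g: "integrable (M \<Otimes>\<^sub>M N) g"
    and ae: "AE z in M \<Otimes>\<^sub>M N. (case z of (x, y) \<Rightarrow> K x y) = g z"
    using integrable_completion_ex[OF K] .
  have [measurable]: "g \<in> borel_measurable (M \<Otimes>\<^sub>M N)" using g by auto
  have "AE x in M. AE y in N. K x y = g (x, y)"
    using AE_pair[OF ae] by simp
  with AE_space have inner: "AE x in M. (LINT y|completion N. K x y) = (LINT y|N. g (x, y))"
  proof eventually_elim
    case (elim x)
    then show ?case by (intro integral_completion_cong_AE) auto
  qed
  have "(LINT x|completion M. LINT y|completion N. K x y) = (LINT x|M. LINT y|N. g (x, y))"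
    by (rule integral_completion_cong_AE[OF _ inner]) measurable
  also have "\<dots> = integral\<^sup>L (M \<Otimes>\<^sub>M N) g"
    using integral_fst'[OF g] .
  also have "\<dots> = integral\<^sup>L (completion (M \<Otimes>\<^sub>M N)) (\<lambda>(x, y). K x y)"
    by (rule integral_completion_cong_AE[OF _ ae, symmetric]) measurable
  finally show ?thesis .
qed

section \<open>Surface measure of a triangle and of its midpoint subdivision\<close>

text \<open>For fixed \<open>v\<close> the term \<open>c1 * v\<close> only translates
  \<open>u\<close>, so two one-dimensional affine substitutions suffice, with determinant
  \<open>b1 * c2\<close>. Up to exchanging the coordinates, every reparametrisation of triangles
  needed below is of this triangular form.\<close>

lemma nn_integral_plane_shear:
  fixes g :: "real \<times> real \<Rightarrow> ennreal"
  assumes g[measurable]: "g \<in> borel_measurable borel" and b: "b1 \<noteq> 0" and c: "c2 \<noteq> 0"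
  shows "(\<integral>\<^sup>+w. g w \<partial>lborel) =
    ennreal \<bar>b1 * c2\<bar> * (\<integral>\<^sup>+(u, v). g (a1 + b1 * u + c1 * v, a2 + c2 * v) \<partial>lborel)"
proof -
  have m: "(\<lambda>(u, v). g (a1 + b1 * u + c1 * v, a2 + c2 * v)) \<in> borel_measurable borel"
    unfolding case_prod_beta'
    by (rule measurable_compose[OF _ g], intro borel_measurable_continuous_onI continuous_intros)
  have "(\<integral>\<^sup>+w. g w \<partial>lborel) = (\<integral>\<^sup>+v. \<integral>\<^sup>+u. g (u, v) \<partial>lborel \<partial>lborel)"
    unfolding lborel_prod[symmetric] by (subst lborel_pair.nn_integral_snd) (auto simp: lborel_prod)
  also have "\<dots> = ennreal \<bar>c2\<bar> * (\<integral>\<^sup>+v. \<integral>\<^sup>+u. g (u, a2 + c2 * v) \<partial>lborel \<partial>lborel)"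
    by (subst nn_integral_real_affine[OF _ c, where t=a2]) auto
  also have "(\<integral>\<^sup>+v. \<integral>\<^sup>+u. g (u, a2 + c2 * v) \<partial>lborel \<partial>lborel) =
      (\<integral>\<^sup>+v. ennreal \<bar>b1\<bar> *
        (\<integral>\<^sup>+u. g (a1 + b1 * u + c1 * v, a2 + c2 * v) \<partial>lborel) \<partial>lborel)"
  proof (rule nn_integral_cong)
    fix v :: real
    show "(\<integral>\<^sup>+u. g (u, a2 + c2 * v) \<partial>lborel) =
        ennreal \<bar>b1\<bar> * (\<integral>\<^sup>+u. g (a1 + b1 * u + c1 * v, a2 + c2 * v) \<partial>lborel)"
      by (subst nn_integral_real_affine[OF _ b, where t="a1 + c1 * v"]) (auto simp: add_ac)
  qed
  also have "\<dots> = ennreal \<bar>b1\<bar> *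
      (\<integral>\<^sup>+v. \<integral>\<^sup>+u. g (a1 + b1 * u + c1 * v, a2 + c2 * v) \<partial>lborel \<partial>lborel)"
    by (subst nn_integral_cmult) auto
  also have "(\<integral>\<^sup>+v. \<integral>\<^sup>+u. g (a1 + b1 * u + c1 * v, a2 + c2 * v) \<partial>lborel \<partial>lborel) =
      (\<integral>\<^sup>+(u, v). g (a1 + b1 * u + c1 * v, a2 + c2 * v) \<partial>lborel)"
    using m unfolding lborel_prod[symmetric]
    by (subst lborel_pair.nn_integral_snd[symmetric]) (auto simp: lborel_prod)
  finally show ?thesis
    by (simp add: abs_mult ennreal_mult mult_ac)
qed

lemma nn_integral_plane_swap:
  fixes g :: "real \<times> real \<Rightarrow> ennreal"
  assumes g[measurable]: "g \<in> borel_measurable borel"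
  shows "(\<integral>\<^sup>+w. g w \<partial>lborel) = (\<integral>\<^sup>+(u, v). g (v, u) \<partial>lborel)"
proof -
  have m: "(\<lambda>(u, v). g (v, u)) \<in> borel_measurable borel"
    unfolding case_prod_beta'
    by (rule measurable_compose[OF _ g], intro borel_measurable_continuous_onI continuous_intros)
  have "(\<integral>\<^sup>+w. g w \<partial>lborel) = (\<integral>\<^sup>+v. \<integral>\<^sup>+u. g (u, v) \<partial>lborel \<partial>lborel)"
    unfolding lborel_prod[symmetric] by (subst lborel_pair.nn_integral_snd) (auto simp: lborel_prod)
  also have "\<dots> = (\<integral>\<^sup>+(u, v). g (v, u) \<partial>lborel)"
    using m unfolding lborel_prod[symmetric]
    by (subst lborel.nn_integral_fst[symmetric]) (auto simp: lborel_prod)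
  finally show ?thesis .
qed

text \<open>Applied to the lines along which the pieces of the subdivided parameter triangle
  overlap.\<close>

lemma AE_plane_not_line:
  fixes a b d :: real
  assumes "(a, b) \<noteq> 0"
  shows "AE w in lborel. a * fst w + b * snd w \<noteq> d"
proof -
  have "negligible {w :: real \<times> real. (a, b) \<bullet> w = d}"
    using negligible_hyperplane[of "(a, b)" d] assms by auto
  moreover have "closed {w :: real \<times> real. (a, b) \<bullet> w = d}"
    by (rule closed_hyperplane)
  ultimately have "{w :: real \<times> real. (a, b) \<bullet> w = d} \<in> null_sets lborel"
    by (simp add: null_sets_completion_iff negligible_iff_null_sets)
  then show ?thesis
    by (rule AE_I') (auto simp: inner_prod_def)
qed

section \<open>Surface measure in the coordinates of the reference triangle\<close>

lemma tri_param_eq: "tri_param (a, b, c) = (\<lambda>w. a + fst w *\<^sub>R (b - a) + snd w *\<^sub>R (c - a))"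
  by (auto simp: fun_eq_iff)

lemma borel_measurable_tri_param [measurable]: "tri_param t \<in> borel_measurable borel"
  by (cases t) (auto simp: tri_param_eq simp del: tri_param.simps
      intro!: borel_measurable_continuous_onI continuous_intros)

lemma sets_ref_triangle [measurable]: "ref_triangle \<in> sets borel"
proof -
  have "closed {w :: real \<times> real. 0 \<le> fst w \<and> 0 \<le> snd w \<and> fst w + snd w \<le> 1}"
    by (intro closed_Collect_conj closed_Collect_le continuous_intros)
  moreover have "ref_triangle = {w. 0 \<le> fst w \<and> 0 \<le> snd w \<and> fst w + snd w \<le> 1}"
    by (auto simp: ref_triangle_def)
  ultimately show ?thesis by simp
qed

text \<open>Twice the area of the triangle, because the reference triangle has area 1/2.\<close>

fun area_factor :: "triangle \<Rightarrow> real" where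
  "area_factor (a, b, c) = norm (cross3 (b - a) (c - a))"

lemma area_factor_nonneg [simp]: "0 \<le> area_factor t"
  by (cases t) auto

lemma sets_surface_measure [simp, measurable_cong]: "sets (surface_measure t) = sets borel"
  by (cases t) auto

lemma space_surface_measure [simp]: "space (surface_measure t) = UNIV"
  using sets_eq_imp_space_eq[OF sets_surface_measure[of t]] by simp

lemma nn_integral_surface_measure:
  assumes [measurable]: "g \<in> borel_measurable borel"
  shows "(\<integral>\<^sup>+x. g x \<partial>surface_measure t) =
    ennreal (area_factor t) *
      (\<integral>\<^sup>+w. indicator ref_triangle w * g (tri_param t w) \<partial>lborel)"
proof -
  have "surface_measure t = scale_measure (ennreal (area_factor t))
      (distr (restrict_space lborel ref_triangle) borel (tri_param t))"
    by (cases t) auto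
  moreover have "tri_param t \<in> measurable (restrict_space lborel ref_triangle) borel"
    by (intro measurable_restrict_space1) auto
  ultimately show ?thesis
    by (auto simp: nn_integral_scale_measure nn_integral_distr nn_integral_restrict_space mult.commute)
qed

lemma emeasure_surface_measure:
  assumes [measurable]: "A \<in> sets borel"
  shows "emeasure (surface_measure t) A =
    ennreal (area_factor t) *
      (\<integral>\<^sup>+w. indicator ref_triangle w * indicator A (tri_param t w) \<partial>lborel)"
  using nn_integral_surface_measure[of "indicator A" t] by simp

lemma surface_measure_eqI:
  assumes "\<And>g :: real^3 \<Rightarrow> ennreal. g \<in> borel_measurable borel \<Longrightarrow>
    (\<integral>\<^sup>+x. g x \<partial>surface_measure t) = (\<integral>\<^sup>+x. g x \<partial>surface_measure t')"
  shows "surface_measure t = surface_measure t'"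
proof (rule measure_eqI)
  fix A assume "A \<in> sets (surface_measure t)"
  then show "emeasure (surface_measure t) A = emeasure (surface_measure t') A"
    using assms[of "indicator A"] by simp
qed simp

text \<open>\<open>U\<close> is the image of the reference triangle under the shear: the full
  reference triangle when \<open>t'\<close> merely reorders the vertices of \<open>t\<close>, a
  quarter of it when \<open>t'\<close> is a subtriangle.\<close>

lemma nn_integral_tri_param_shear:
  fixes g :: "real^3 \<Rightarrow> ennreal"
  assumes [measurable]: "g \<in> borel_measurable borel" "U \<in> sets borel"
    and "b1 \<noteq> 0" "c2 \<noteq> 0"
    and U: "\<And>u v. (a1 + b1 * u + c1 * v, a2 + c2 * v) \<in> U \<longleftrightarrow> (u, v) \<in> ref_triangle"
    and t': "\<And>u v. tri_param t (a1 + b1 * u + c1 * v, a2 + c2 * v) = tri_param t' (u, v)"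
  shows "(\<integral>\<^sup>+w. indicator U w * g (tri_param t w) \<partial>lborel) =
    ennreal \<bar>b1 * c2\<bar> * (\<integral>\<^sup>+w. indicator ref_triangle w * g (tri_param t' w) \<partial>lborel)"
proof -
  have "(\<integral>\<^sup>+w. indicator U w * g (tri_param t w) \<partial>lborel) =
      ennreal \<bar>b1 * c2\<bar> * (\<integral>\<^sup>+(u, v). indicator U (a1 + b1 * u + c1 * v, a2 + c2 * v) *
        g (tri_param t (a1 + b1 * u + c1 * v, a2 + c2 * v)) \<partial>lborel)"
    by (rule nn_integral_plane_shear) (use assms in measurable)
  also have "(\<lambda>(u, v). indicator U (a1 + b1 * u + c1 * v, a2 + c2 * v) *
        g (tri_param t (a1 + b1 * u + c1 * v, a2 + c2 * v))) =
      (\<lambda>w. indicator ref_triangle w * g (tri_param t' w))"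
    by (auto simp: fun_eq_iff indicator_def U t')
  finally show ?thesis .
qed

lemma nn_integral_tri_param_shear_swap:
  fixes g :: "real^3 \<Rightarrow> ennreal"
  assumes [measurable]: "g \<in> borel_measurable borel" "U \<in> sets borel"
    and "b1 \<noteq> 0" "c2 \<noteq> 0"
    and U: "\<And>u v. (a2 + c2 * v, a1 + b1 * u + c1 * v) \<in> U \<longleftrightarrow> (u, v) \<in> ref_triangle"
    and t': "\<And>u v. tri_param t (a2 + c2 * v, a1 + b1 * u + c1 * v) = tri_param t' (u, v)"
  shows "(\<integral>\<^sup>+w. indicator U w * g (tri_param t w) \<partial>lborel) =
    ennreal \<bar>b1 * c2\<bar> * (\<integral>\<^sup>+w. indicator ref_triangle w * g (tri_param t' w) \<partial>lborel)"
proof -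
  let ?h = "\<lambda>w. indicator U (snd w, fst w) * g (tri_param t (snd w, fst w))"
  have "(\<integral>\<^sup>+w. indicator U w * g (tri_param t w) \<partial>lborel) =
      (\<integral>\<^sup>+(u, v). indicator U (v, u) * g (tri_param t (v, u)) \<partial>lborel)"
    by (rule nn_integral_plane_swap) (use assms in measurable)
  also have "\<dots> = integral\<^sup>N lborel ?h"
    by (simp add: case_prod_beta')
  also have "\<dots> = ennreal \<bar>b1 * c2\<bar> *
      (\<integral>\<^sup>+(u, v). ?h (a1 + b1 * u + c1 * v, a2 + c2 * v) \<partial>lborel)"
  proof (rule nn_integral_plane_shear)
    have [measurable]: "(\<lambda>w :: real \<times> real. (snd w, fst w)) \<in> borel_measurable borel"
      by (intro borel_measurable_continuous_onI continuous_intros)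
    show "?h \<in> borel_measurable borel"
      by measurable
  qed (use assms in auto)
  also have "(\<lambda>(u, v). ?h (a1 + b1 * u + c1 * v, a2 + c2 * v)) =
      (\<lambda>w. indicator ref_triangle w * g (tri_param t' w))"
    by (auto simp: fun_eq_iff indicator_def U t')
  finally show ?thesis .
qed

lemma surface_measure_swap12: "surface_measure (b, a, c) = surface_measure (a, b, c)"
proof (rule surface_measure_eqI)
  fix g :: "real^3 \<Rightarrow> ennreal" assume g: "g \<in> borel_measurable borel"
  have "cross3 (a - b) (c - b) = - cross3 (b - a) (c - a)"
    by (simp add: cross3_simps)
  then have area: "area_factor (b, a, c) = area_factor (a, b, c)"
    by simp
  have "(\<integral>\<^sup>+w. indicator ref_triangle w * g (tri_param (a, b, c) w) \<partial>lborel) =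
      ennreal \<bar>- 1 * 1\<bar> * (\<integral>\<^sup>+w. indicator ref_triangle w * g (tri_param (b, a, c) w) \<partial>lborel)"
    \<comment> \<open>The map sends \<open>(u, v)\<close> to \<open>(1 - u - v, v)\<close>: it
      exchanges the barycentric weights of the first two vertices.\<close>
    by (rule nn_integral_tri_param_shear[OF g sets_ref_triangle, where ?c1.0="-1" and ?a1.0=1 and ?a2.0=0])
       (auto simp: ref_triangle_def algebra_simps)
  then show "(\<integral>\<^sup>+x. g x \<partial>surface_measure (b, a, c)) = (\<integral>\<^sup>+x. g x \<partial>surface_measure (a, b, c))"
    by (simp add: nn_integral_surface_measure[OF g] area del: area_factor.simps surface_measure.simps)
qed

lemma surface_measure_swap23: "surface_measure (a, c, b) = surface_measure (a, b, c)"
proof (rule surface_measure_eqI)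
  fix g :: "real^3 \<Rightarrow> ennreal" assume g: "g \<in> borel_measurable borel"
  have "cross3 (c - a) (b - a) = - cross3 (b - a) (c - a)"
    by (simp add: cross3_simps)
  then have area: "area_factor (a, c, b) = area_factor (a, b, c)"
    by simp
  have "(\<integral>\<^sup>+w. indicator ref_triangle w * g (tri_param (a, b, c) w) \<partial>lborel) =
      ennreal \<bar>1 * 1\<bar> * (\<integral>\<^sup>+w. indicator ref_triangle w * g (tri_param (a, c, b) w) \<partial>lborel)"
    by (rule nn_integral_tri_param_shear_swap[OF g sets_ref_triangle, where ?c1.0=0 and ?a1.0=0 and ?a2.0=0])
       (auto simp: ref_triangle_def algebra_simps)
  then show "(\<integral>\<^sup>+x. g x \<partial>surface_measure (a, c, b)) = (\<integral>\<^sup>+x. g x \<partial>surface_measure (a, b, c))"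
    by (simp add: nn_integral_surface_measure[OF g] area del: area_factor.simps surface_measure.simps)
qed

section \<open>Midpoint subdivision and contraction towards the vertices\<close>

lemma area_factor_sub:
  "area_factor (sub1 t) = area_factor t / 4" "area_factor (sub2 t) = area_factor t / 4"
  "area_factor (sub3 t) = area_factor t / 4" "area_factor (sub4 t) = area_factor t / 4"
proof -
  obtain a b c where t: "t = (a, b, c)" by (cases t)
  let ?d = "cross3 (b - a) (c - a)"
  have "cross3 (midpoint a b - a) (midpoint a c - a) = (1/4) *\<^sub>R ?d"
    "cross3 (midpoint a b - b) (midpoint b c - b) = - (1/4) *\<^sub>R ?d"
    "cross3 (midpoint a c - c) (midpoint b c - c) = (1/4) *\<^sub>R ?d"
    "cross3 (midpoint b c - midpoint a b) (midpoint a c - midpoint a b) = (1/4) *\<^sub>R ?d"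
    by (simp_all add: midpoint_def cross3_simps field_simps)
  then show "area_factor (sub1 t) = area_factor t / 4" "area_factor (sub2 t) = area_factor t / 4"
    "area_factor (sub3 t) = area_factor t / 4" "area_factor (sub4 t) = area_factor t / 4"
    by (simp_all add: t)
qed

text \<open>The redundant terms and signs make the right-hand sides literal instances of the shears
  \<open>(a1 + b1 * u + c1 * v, a2 + c2 * v)\<close> above, with swapped coordinates in the last two cases.\<close>

lemma tri_param_sub:
  "tri_param (sub1 t) (u, v) = tri_param t (0 + 1/2 * u + 0 * v, 0 + 1/2 * v)"
  "tri_param (sub2 t) (u, v) = tri_param t (1 + - 1/2 * u + - 1/2 * v, 0 + 1/2 * v)"
  "tri_param (sub3 t) (u, v) = tri_param t (0 + 1/2 * v, 1 + - 1/2 * u + - 1/2 * v)"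
  "tri_param (sub4 t) (u, v) = tri_param t (1/2 + - 1/2 * v, 0 + 1/2 * u + 1/2 * v)"
  by (cases t; simp add: midpoint_def vec_eq_iff; simp add: field_simps)+

lemma nn_integral_surface_measure_sub:
  fixes g :: "real^3 \<Rightarrow> ennreal"
  assumes [measurable]: "g \<in> borel_measurable borel"
  shows "(\<integral>\<^sup>+x. g x \<partial>surface_measure t) =
    (\<integral>\<^sup>+x. g x \<partial>surface_measure (sub1 t)) + (\<integral>\<^sup>+x. g x \<partial>surface_measure (sub2 t)) +
    (\<integral>\<^sup>+x. g x \<partial>surface_measure (sub3 t)) + (\<integral>\<^sup>+x. g x \<partial>surface_measure (sub4 t))"
proof -
  \<comment> \<open>These are the parameter domains of the four subtriangles. The three inequalities
    of \<open>T4\<close> already force both coordinates to be nonnegative with sum at most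
    1.\<close>
  define T1 T2 T3 T4 :: "(real \<times> real) set" where
    "T1 = {w. 0 \<le> fst w \<and> 0 \<le> snd w \<and> fst w + snd w \<le> 1/2}" and
    "T2 = {w. 1/2 \<le> fst w \<and> 0 \<le> snd w \<and> fst w + snd w \<le> 1}" and
    "T3 = {w. 0 \<le> fst w \<and> 1/2 \<le> snd w \<and> fst w + snd w \<le> 1}" and
    "T4 = {w. fst w \<le> 1/2 \<and> snd w \<le> 1/2 \<and> 1/2 \<le> fst w + snd w}"
  note T_defs = T1_def T2_def T3_def T4_def
  have "closed T1" "closed T2" "closed T3" "closed T4"
    unfolding T_defs
    by (intro closed_Collect_conj closed_Collect_le continuous_intros)+
  then have T[measurable]: "T1 \<in> sets borel" "T2 \<in> sets borel" "T3 \<in> sets borel" "T4 \<in> sets borel"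
    by auto
  define H where "H = (\<lambda>T. \<integral>\<^sup>+w. indicator T w * g (tri_param t w) \<partial>lborel)"
  define J where "J = (\<lambda>t'. \<integral>\<^sup>+w. indicator ref_triangle w * g (tri_param t' w) \<partial>lborel)"
  have 1: "H T1 = ennreal \<bar>1/2 * (1/2)\<bar> * J (sub1 t)"
    unfolding H_def J_def
    by (rule nn_integral_tri_param_shear[OF assms T(1) _ _ _ tri_param_sub(1)[symmetric]])
       (auto simp: ref_triangle_def T_defs)
  have 2: "H T2 = ennreal \<bar>- 1/2 * (1/2)\<bar> * J (sub2 t)"
    unfolding H_def J_def
    by (rule nn_integral_tri_param_shear[OF assms T(2) _ _ _ tri_param_sub(2)[symmetric]])
       (auto simp: ref_triangle_def T_defs)
  have 3: "H T3 = ennreal \<bar>- 1/2 * (1/2)\<bar> * J (sub3 t)"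
    unfolding H_def J_def
    by (rule nn_integral_tri_param_shear_swap[OF assms T(3) _ _ _ tri_param_sub(3)[symmetric]])
       (auto simp: ref_triangle_def T_defs)
  have 4: "H T4 = ennreal \<bar>1/2 * (- 1/2)\<bar> * J (sub4 t)"
    unfolding H_def J_def
    by (rule nn_integral_tri_param_shear_swap[OF assms T(4) _ _ _ tri_param_sub(4)[symmetric]])
       (auto simp: ref_triangle_def T_defs)
  \<comment> \<open>The sides of the central piece lie on these three lines. Off them, each point of
    the reference triangle belongs to exactly one piece, so the indicators add up.\<close>
  have "AE w in lborel. 1 * fst w + 0 * snd w \<noteq> (1/2 :: real)"
    "AE w in lborel. 0 * fst w + 1 * snd w \<noteq> (1/2 :: real)"
    "AE w in lborel. 1 * fst w + 1 * snd w \<noteq> (1/2 :: real)"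
    by (rule AE_plane_not_line; simp add: zero_prod_def)+
  then have "H ref_triangle = (\<integral>\<^sup>+w. indicator T1 w * g (tri_param t w) +
      indicator T2 w * g (tri_param t w) + indicator T3 w * g (tri_param t w) +
      indicator T4 w * g (tri_param t w) \<partial>lborel)"
    unfolding H_def
  proof (intro nn_integral_cong_AE, eventually_elim)
    case (elim w)
    then show ?case
      by (cases w) (auto simp: ref_triangle_def T_defs indicator_def)
  qed
  also have "\<dots> = H T1 + H T2 + H T3 + H T4"
    unfolding H_def by (simp add: nn_integral_add)
  finally have "ennreal (area_factor t) * H ref_triangle =
      ennreal (area_factor t) * (ennreal (1/4) * J (sub1 t) + ennreal (1/4) * J (sub2 t) +
        ennreal (1/4) * J (sub3 t) + ennreal (1/4) * J (sub4 t))"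
    unfolding 1 2 3 4 by simp
  also have "\<dots> = ennreal (area_factor t / 4) * J (sub1 t) + ennreal (area_factor t / 4) * J (sub2 t) +
        ennreal (area_factor t / 4) * J (sub3 t) + ennreal (area_factor t / 4) * J (sub4 t)"
  proof -
    have "ennreal (area_factor t / 4) = ennreal (area_factor t) * ennreal (1/4)"
      by (subst ennreal_mult[symmetric]) auto
    then show ?thesis by (simp add: distrib_left mult.assoc)
  qed
  finally show ?thesis
    by (simp add: nn_integral_surface_measure area_factor_sub H_def J_def)
qed

text \<open>At equal parameters, the point of the corner triangle is the midpoint of
  \<open>a\<close> and the point of the full triangle; the factor 1/4 is the ratio of areas.\<close>

lemma nn_integral_surface_measure_sub1:
  fixes g :: "real^3 \<Rightarrow> ennreal"
  assumes [measurable]: "g \<in> borel_measurable borel"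
  shows "(\<integral>\<^sup>+x. g x \<partial>surface_measure (sub1 (a, b, c))) =
    ennreal (1/4) * (\<integral>\<^sup>+x. g (midpoint a x) \<partial>surface_measure (a, b, c))"
proof -
  have "midpoint a \<in> borel_measurable borel"
    unfolding midpoint_def by measurable
  moreover have "tri_param (sub1 (a, b, c)) w = midpoint a (tri_param (a, b, c) w)" for w
    by (cases w) (simp add: midpoint_def vec_eq_iff field_simps)
  moreover have "ennreal (area_factor (a, b, c) / 4) = ennreal (1/4) * ennreal (area_factor (a, b, c))"
    by (subst ennreal_mult[symmetric]) auto
  ultimately show ?thesis
    by (simp add: nn_integral_surface_measure area_factor_sub mult.assoc
        del: area_factor.simps surface_measure.simps sub1.simps tri_param.simps)
qed

text \<open>Listing \<open>b\<close> first turns this corner into a first corner, and the surface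
  measure is insensitive to the order of the vertices.\<close>

lemma nn_integral_surface_measure_sub2:
  fixes g :: "real^3 \<Rightarrow> ennreal"
  assumes "g \<in> borel_measurable borel"
  shows "(\<integral>\<^sup>+x. g x \<partial>surface_measure (sub2 (a, b, c))) =
    ennreal (1/4) * (\<integral>\<^sup>+x. g (midpoint b x) \<partial>surface_measure (a, b, c))"
proof -
  have "sub2 (a, b, c) = sub1 (b, a, c)"
    by (simp add: midpoint_sym)
  then show ?thesis
    using nn_integral_surface_measure_sub1[OF assms, of b a c] by (simp only: surface_measure_swap12)
qed

lemma nn_integral_surface_measure_sub3:
  fixes g :: "real^3 \<Rightarrow> ennreal"
  assumes "g \<in> borel_measurable borel"
  shows "(\<integral>\<^sup>+x. g x \<partial>surface_measure (sub3 (a, b, c))) =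
    ennreal (1/4) * (\<integral>\<^sup>+x. g (midpoint c x) \<partial>surface_measure (a, b, c))"
proof -
  have "sub3 (a, b, c) = sub1 (c, a, b)"
    by (simp add: midpoint_sym)
  moreover have "surface_measure (c, a, b) = surface_measure (a, b, c)"
    using surface_measure_swap12[of c a b] surface_measure_swap23[of a c b] by (simp only:)
  ultimately show ?thesis
    using nn_integral_surface_measure_sub1[OF assms, of c a b] by (simp only:)
qed

section \<open>Null sets, boundedness and finiteness of surface measure\<close>

text \<open>The first disjunct covers collinear vertices: the surface measure is then zero and every
  property holds almost everywhere.\<close>

lemma AE_surface_measure_iff:
  assumes "Measurable.pred borel P"
  shows "(AE x in surface_measure t. P x) \<longleftrightarrow>
    area_factor t = 0 \<or> (AE w in lborel. w \<in> ref_triangle \<longrightarrow> P (tri_param t w))"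
proof -
  have [measurable]: "{x. \<not> P x} \<in> sets borel"
    using assms by measurable
  have "(AE x in surface_measure t. P x) \<longleftrightarrow>
      (\<integral>\<^sup>+x. indicator {x. \<not> P x} x \<partial>surface_measure t) = 0"
    by (subst AE_iff_measurable[of "{x. \<not> P x}"]) auto
  also have "\<dots> \<longleftrightarrow> area_factor t = 0 \<or>
      (AE w in lborel. indicator ref_triangle w * indicator {x. \<not> P x} (tri_param t w) = (0::ennreal))"
    by (subst nn_integral_surface_measure) (auto simp: nn_integral_0_iff_AE)
  finally show ?thesis
    by (auto simp: indicator_def)
qed

text \<open>For positive area the parametrisation is injective, so a point has a finite, hence null,
  preimage. Through Fubini this makes the diagonal \<open>x = x'\<close> a null set of the
  product.\<close>

lemma AE_surface_measure_not_point: "AE x in surface_measure t. x \<noteq> y"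
proof (cases "area_factor t = 0")
  case False
  obtain a b c where t: "t = (a, b, c)" by (cases t)
  have "inj (tri_param t)"
  proof (rule injI)
    fix w w' assume "tri_param t w = tri_param t w'"
    then have eq: "(fst w - fst w') *\<^sub>R (b - a) + (snd w - snd w') *\<^sub>R (c - a) = 0"
      by (simp add: t tri_param_eq algebra_simps del: tri_param.simps)
    \<comment> \<open>Taking the cross product with one edge vector kills its own coefficient and
      isolates the other one.\<close>
    have "(fst w - fst w') *\<^sub>R cross3 (b - a) (c - a) =
        cross3 ((fst w - fst w') *\<^sub>R (b - a) + (snd w - snd w') *\<^sub>R (c - a)) (c - a)"
      "(snd w - snd w') *\<^sub>R cross3 (b - a) (c - a) =
        cross3 (b - a) ((fst w - fst w') *\<^sub>R (b - a) + (snd w - snd w') *\<^sub>R (c - a))"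
      by (simp_all add: cross_add_left cross_mult_left cross_add_right cross_mult_right)
    with False show "w = w'"
      unfolding eq by (simp add: t prod_eq_iff)
  qed
  then have "finite (tri_param t -` {y})"
    by (intro finite_vimageI) auto
  then have "AE w in lborel. w \<notin> tri_param t -` {y}"
    by (intro AE_not_in finite_imp_null_set_lborel)
  then have "AE w in lborel. w \<in> ref_triangle \<longrightarrow> tri_param t w \<noteq> y"
    by eventually_elim auto
  then show ?thesis
    by (subst AE_surface_measure_iff) auto
qed (simp add: AE_surface_measure_iff)

lemma AE_surface_measure_bounded: "AE x in surface_measure (a, b, c).
  norm x \<le> norm a + norm (b - a) + norm (c - a)"
proof -
  have "norm (tri_param (a, b, c) w) \<le> norm a + norm (b - a) + norm (c - a)"
    if "w \<in> ref_triangle" for w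
  proof -
    have "0 \<le> fst w" "fst w \<le> 1" "0 \<le> snd w" "snd w \<le> 1"
      using that by (auto simp: ref_triangle_def)
    then have "norm (fst w *\<^sub>R (b - a)) \<le> norm (b - a)" "norm (snd w *\<^sub>R (c - a)) \<le> norm (c - a)"
      by (auto intro!: mult_left_le_one_le)
    then show ?thesis
      unfolding tri_param_eq by (intro norm_triangle_mono order_refl)
  qed
  then show ?thesis
    by (subst AE_surface_measure_iff) auto
qed

lemma finite_measure_surface_measure: "finite_measure (surface_measure t)"
proof
  have "emeasure (surface_measure t) UNIV =
      ennreal (area_factor t) * emeasure lborel ref_triangle"
    by (subst emeasure_surface_measure) auto
  moreover have "bounded ref_triangle"
  proof (rule bounded_subset)
    show "ref_triangle \<subseteq> {0..1} \<times> {0..1}"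
      by (auto simp: ref_triangle_def)
  qed (intro bounded_Times bounded_closed_interval)
  ultimately show "emeasure (surface_measure t) (space (surface_measure t)) \<noteq> \<infinity>"
    using emeasure_bounded_finite[of ref_triangle] by (simp add: ennreal_mult_eq_top_iff)
qed

section \<open>Double integrals over pairs of triangles\<close>

lemma sigma_finite_surface_measure: "sigma_finite_measure (surface_measure t)"
  using finite_measure_surface_measure by (rule finite_measure.axioms(1))

lemma sets_pair_surface_measure [measurable_cong]:
  "sets (surface_measure B \<Otimes>\<^sub>M surface_measure A) = sets (borel \<Otimes>\<^sub>M borel)"
  by (intro sets_pair_measure_cong sets_surface_measure)

lemma space_pair_surface_measure [simp]:
  "space (surface_measure B \<Otimes>\<^sub>M surface_measure A) = UNIV"
  by (simp add: space_pair_measure)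

lemma emeasure_pair_surface_measure:
  assumes "E \<in> sets (borel \<Otimes>\<^sub>M borel)"
  shows "emeasure (surface_measure B \<Otimes>\<^sub>M surface_measure A) E =
    (\<integral>\<^sup>+x. \<integral>\<^sup>+y. indicator E (x, y) \<partial>surface_measure A \<partial>surface_measure B)"
proof -
  interpret sigma_finite_measure "surface_measure A" by (rule sigma_finite_surface_measure)
  show ?thesis
    using assms by (intro emeasure_pair_measure) (simp add: sets_pair_surface_measure)
qed

lemma borel_measurable_nn_integral_surface_measure [measurable]:
  assumes "E \<in> sets (borel \<Otimes>\<^sub>M borel)" and [measurable]: "h \<in> borel_measurable borel"
  shows "(\<lambda>x. \<integral>\<^sup>+y. indicator E (h x, y) \<partial>surface_measure A) \<in> borel_measurable borel"
proof -
  interpret sigma_finite_measure "surface_measure A" by (rule sigma_finite_surface_measure)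
  note assms(1)[measurable]
  show ?thesis by measurable
qed

lemma tri_integral_eq:
  assumes "abs_integrable_over K A B"
  shows "tri_integral K A B =
    integral\<^sup>L (completion (surface_measure B \<Otimes>\<^sub>M surface_measure A)) (\<lambda>(x, x'). K x x')"
  using assms unfolding tri_integral_def abs_integrable_over_def
  by (intro integral_completion_pair sigma_finite_surface_measure)

text \<open>Indexing the pieces lets the subdivision be used as a finite sum of measures. Indices
  start at 0, so \<open>subdiv t i\<close> is piece number \<open>i + 1\<close>.\<close>

definition subdiv :: "triangle \<Rightarrow> nat \<Rightarrow> triangle" where
  "subdiv t i = [sub1 t, sub2 t, sub3 t, sub4 t] ! i"

lemma nn_integral_subdiv:
  assumes "g \<in> borel_measurable borel"
  shows "(\<integral>\<^sup>+x. g x \<partial>surface_measure t) = (\<Sum>i<4. \<integral>\<^sup>+x. g x \<partial>surface_measure (subdiv t i))"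
  unfolding nn_integral_surface_measure_sub[OF assms, of t]
  by (simp add: subdiv_def numeral_eq_Suc)

text \<open>Integrability on each piece is part of the conclusion because the pieces are
  subsequently split in the other variable.\<close>

lemma tri_integral_split_src:
  assumes K: "abs_integrable_over K A B"
  shows "(\<forall>i<4. abs_integrable_over K (subdiv A i) B) \<and>
    tri_integral K A B = (\<Sum>i<4. tri_integral K (subdiv A i) B)"
proof -
  have "(\<forall>i\<in>{..<4}. integrable (completion (surface_measure B \<Otimes>\<^sub>M surface_measure (subdiv A i)))
        (\<lambda>(x, x'). K x x')) \<and>
    integral\<^sup>L (completion (surface_measure B \<Otimes>\<^sub>M surface_measure A)) (\<lambda>(x, x'). K x x') =
    (\<Sum>i<4. integral\<^sup>L (completion (surface_measure B \<Otimes>\<^sub>M surface_measure (subdiv A i)))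
      (\<lambda>(x, x'). K x x'))"
  proof (rule integral_completion_sum_measure)
    fix E assume "E \<in> sets (surface_measure B \<Otimes>\<^sub>M surface_measure A)"
    then have E[measurable]: "E \<in> sets (borel \<Otimes>\<^sub>M borel)"
      by (simp add: sets_pair_surface_measure)
    have "(\<integral>\<^sup>+y. indicator E (x, y) \<partial>surface_measure A) =
        (\<Sum>i<4. \<integral>\<^sup>+y. indicator E (x, y) \<partial>surface_measure (subdiv A i))" for x
      by (rule nn_integral_subdiv) measurable
    then show "emeasure (surface_measure B \<Otimes>\<^sub>M surface_measure A) E =
        (\<Sum>i<4. emeasure (surface_measure B \<Otimes>\<^sub>M surface_measure (subdiv A i)) E)"
      by (simp add: emeasure_pair_surface_measure[OF E] nn_integral_sum)
  qed (use K in \<open>auto simp: abs_integrable_over_def sets_pair_surface_measure\<close>)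
  with K show ?thesis
    by (auto simp: tri_integral_eq abs_integrable_over_def)
qed

lemma tri_integral_split_rcv:
  assumes K: "abs_integrable_over K A B"
  shows "(\<forall>i<4. abs_integrable_over K A (subdiv B i)) \<and>
    tri_integral K A B = (\<Sum>i<4. tri_integral K A (subdiv B i))"
proof -
  have "(\<forall>i\<in>{..<4}. integrable (completion (surface_measure (subdiv B i) \<Otimes>\<^sub>M surface_measure A))
        (\<lambda>(x, x'). K x x')) \<and>
    integral\<^sup>L (completion (surface_measure B \<Otimes>\<^sub>M surface_measure A)) (\<lambda>(x, x'). K x x') =
    (\<Sum>i<4. integral\<^sup>L (completion (surface_measure (subdiv B i) \<Otimes>\<^sub>M surface_measure A))
      (\<lambda>(x, x'). K x x'))"
  proof (rule integral_completion_sum_measure)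
    fix E assume "E \<in> sets (surface_measure B \<Otimes>\<^sub>M surface_measure A)"
    then have E[measurable]: "E \<in> sets (borel \<Otimes>\<^sub>M borel)"
      by (simp add: sets_pair_surface_measure)
    show "emeasure (surface_measure B \<Otimes>\<^sub>M surface_measure A) E =
        (\<Sum>i<4. emeasure (surface_measure (subdiv B i) \<Otimes>\<^sub>M surface_measure A) E)"
      unfolding emeasure_pair_surface_measure[OF E]
      by (rule nn_integral_subdiv) measurable
  qed (use K in \<open>auto simp: abs_integrable_over_def sets_pair_surface_measure\<close>)
  with K show ?thesis
    by (auto simp: tri_integral_eq abs_integrable_over_def)
qed

text \<open>Inclusion-exclusion: \<open>(sub1 S, R)\<close> and \<open>(S, sub1 R)\<close> together
  collect every pair containing a first corner, with \<open>(sub1 S, sub1 R)\<close> counted twice.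
  Of the nine pairs left over, the remainder lists seven.\<close>

lemma tri_integral_two_touch:
  assumes K: "abs_integrable_over K S R"
  shows "abs_integrable_over K (sub2 S) (sub3 R)" "abs_integrable_over K (sub3 S) (sub2 R)"
    "tri_integral K S R = two_touch_remainder (tri_integral K) S R +
      tri_integral K (sub2 S) (sub3 R) + tri_integral K (sub3 S) (sub2 R)"
proof -
  have src: "(abs_integrable_over K (sub1 A) B \<and> abs_integrable_over K (sub2 A) B \<and>
        abs_integrable_over K (sub3 A) B \<and> abs_integrable_over K (sub4 A) B) \<and>
      tri_integral K A B = tri_integral K (sub1 A) B + tri_integral K (sub2 A) B +
        tri_integral K (sub3 A) B + tri_integral K (sub4 A) B"
    if "abs_integrable_over K A B" for A B
    using tri_integral_split_src[OF that] by (simp add: subdiv_def numeral_eq_Suc All_less_Suc)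
  have rcv: "(abs_integrable_over K A (sub1 B) \<and> abs_integrable_over K A (sub2 B) \<and>
        abs_integrable_over K A (sub3 B) \<and> abs_integrable_over K A (sub4 B)) \<and>
      tri_integral K A B = tri_integral K A (sub1 B) + tri_integral K A (sub2 B) +
        tri_integral K A (sub3 B) + tri_integral K A (sub4 B)"
    if "abs_integrable_over K A B" for A B
    using tri_integral_split_rcv[OF that] by (simp add: subdiv_def numeral_eq_Suc All_less_Suc)
  show "abs_integrable_over K (sub2 S) (sub3 R)" "abs_integrable_over K (sub3 S) (sub2 R)"
    using src[OF K] rcv by blast+
  show "tri_integral K S R = two_touch_remainder (tri_integral K) S R +
      tri_integral K (sub2 S) (sub3 R) + tri_integral K (sub3 S) (sub2 R)"
    using src[OF K] rcv[OF K] rcv[of "sub2 S" R] rcv[of "sub3 S" R] rcv[of "sub4 S" R]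
      src[of S "sub1 R"]
    by (simp add: two_touch_remainder_def)
qed

text \<open>With the common centre \<open>c\<close>, the product measure of the small pair is 1/4
  times 1/4 of the image of the large one under the map contracting both variables. The hypotheses
  are stated as integral identities so that any corner of either triangle can be inserted.\<close>

lemma tri_integral_homothety:
  assumes A': "\<And>g :: real^3 \<Rightarrow> ennreal. g \<in> borel_measurable borel \<Longrightarrow>
      (\<integral>\<^sup>+x. g x \<partial>surface_measure A') = ennreal (1/4) * (\<integral>\<^sup>+x. g (midpoint c x) \<partial>surface_measure A)"
    and B': "\<And>g :: real^3 \<Rightarrow> ennreal. g \<in> borel_measurable borel \<Longrightarrow>
      (\<integral>\<^sup>+x. g x \<partial>surface_measure B') = ennreal (1/4) * (\<integral>\<^sup>+x. g (midpoint c x) \<partial>surface_measure B)"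
    and K: "abs_integrable_over K A' B'"
  shows "abs_integrable_over (\<lambda>x x'. K (midpoint c x) (midpoint c x')) A B \<and>
    tri_integral K A' B' = 1/16 * tri_integral (\<lambda>x x'. K (midpoint c x) (midpoint c x')) A B"
proof -
  let ?T = "\<lambda>z. (midpoint c (fst z), midpoint c (snd z))"
  let ?Q = "surface_measure B \<Otimes>\<^sub>M surface_measure A"
  let ?Q' = "surface_measure B' \<Otimes>\<^sub>M surface_measure A'"
  have [measurable]: "midpoint c \<in> borel_measurable borel"
    unfolding midpoint_def by measurable
  have T[measurable]: "?T \<in> measurable ?Q (borel \<Otimes>\<^sub>M borel)"
    by measurable
  have eq: "?Q' = scale_measure (ennreal (1/16)) (distr ?Q (borel \<Otimes>\<^sub>M borel) ?T)"
  proof (rule measure_eqI)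
    fix E assume "E \<in> sets ?Q'"
    then have E[measurable]: "E \<in> sets (borel \<Otimes>\<^sub>M borel)"
      by (simp add: sets_pair_surface_measure)
    have "?T \<in> measurable (borel \<Otimes>\<^sub>M borel) (borel \<Otimes>\<^sub>M borel)"
      by measurable
    then have TE[measurable]: "?T -` E \<in> sets (borel \<Otimes>\<^sub>M borel)"
      using measurable_sets[OF _ E, of ?T "borel \<Otimes>\<^sub>M borel"] by (simp add: space_pair_measure)
    have inner: "(\<integral>\<^sup>+y. indicator E (x, y) \<partial>surface_measure A') =
        ennreal (1/4) * (\<integral>\<^sup>+y. indicator E (x, midpoint c y) \<partial>surface_measure A)" for x
      by (rule A') measurable
    have ind: "indicator (?T -` E) (x, y) = (indicator E (midpoint c x, midpoint c y) :: ennreal)" for x y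
      by (simp add: indicator_def)
    have "emeasure ?Q' E = ennreal (1/4) * (\<integral>\<^sup>+x. \<integral>\<^sup>+y.
        indicator E (midpoint c x, y) \<partial>surface_measure A' \<partial>surface_measure B)"
      unfolding emeasure_pair_surface_measure[OF E] by (rule B') measurable
    also have "\<dots> = ennreal (1/4) * (\<integral>\<^sup>+x. ennreal (1/4) * (\<integral>\<^sup>+y.
        indicator (?T -` E) (x, y) \<partial>surface_measure A) \<partial>surface_measure B)"
      unfolding inner ind ..
    also have "\<dots> = ennreal (1/4) * (ennreal (1/4) * emeasure ?Q (?T -` E))"
      unfolding emeasure_pair_surface_measure[OF TE]
      by (subst nn_integral_cmult) (auto intro!: borel_measurable_nn_integral_surface_measure[OF TE, of "\<lambda>x. x"])
    also have "\<dots> = ennreal (1/16) * emeasure ?Q (?T -` E)"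
      by (simp add: mult.assoc[symmetric] ennreal_mult[symmetric])
    finally show "emeasure ?Q' E = emeasure (scale_measure (ennreal (1/16)) (distr ?Q (borel \<Otimes>\<^sub>M borel) ?T)) E"
      by (simp add: emeasure_distr)
  qed (simp add: sets_pair_surface_measure)
  have comp: "(\<lambda>(x, x'). K x x') \<circ> ?T = (\<lambda>(x, x'). K (midpoint c x) (midpoint c x'))"
    by auto
  have "integrable (completion ?Q) (\<lambda>(x, x'). K (midpoint c x) (midpoint c x')) \<and>
    integral\<^sup>L (completion ?Q') (\<lambda>(x, x'). K x x') =
    of_real (1/16) * integral\<^sup>L (completion ?Q) (\<lambda>(x, x'). K (midpoint c x) (midpoint c x'))"
    using integral_completion_scale_distr[OF T, of "1/16" "\<lambda>(x, x'). K x x'"] K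
    unfolding eq[symmetric] comp by (simp add: abs_integrable_over_def)
  with K show ?thesis
    by (simp add: tri_integral_eq abs_integrable_over_def)
qed

section \<open>Almost everywhere comparison, integrability and linearity of kernels\<close>

lemma AE_pair_surface_measureI:
  assumes "Measurable.pred (borel \<Otimes>\<^sub>M borel) P"
    and "AE x in surface_measure B. AE x' in surface_measure A. P (x, x')"
  shows "AE z in surface_measure B \<Otimes>\<^sub>M surface_measure A. P z"
proof -
  interpret B: sigma_finite_measure "surface_measure B" by (rule sigma_finite_surface_measure)
  interpret A: sigma_finite_measure "surface_measure A" by (rule sigma_finite_surface_measure)
  interpret pair_sigma_finite "surface_measure B" "surface_measure A" ..
  show ?thesis
    using assms by (intro AE_pair_measure) (auto simp: sets_pair_surface_measure pred_def space_pair_measure)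
qed

lemma AE_pair_surface_measure_neq:
  "AE z in surface_measure B \<Otimes>\<^sub>M surface_measure A. fst z \<noteq> snd z"
proof (rule AE_pair_surface_measureI)
  show "AE x in surface_measure B. AE x' in surface_measure A. fst (x, x') \<noteq> snd (x, x')"
    using AE_surface_measure_not_point by (auto simp: eq_commute)
qed measurable

lemma AE_pair_surface_measure_bounded:
  obtains C where "AE z in surface_measure B \<Otimes>\<^sub>M surface_measure A. norm (fst z) \<le> C \<and> norm (snd z) \<le> C"
proof -
  have ex: "\<exists>C. AE x in surface_measure t. norm x \<le> C" for t
    using AE_surface_measure_bounded by (cases t) blast
  from ex[of A] ex[of B] obtain CA CB where
    C: "AE x' in surface_measure A. norm x' \<le> CA" "AE x in surface_measure B. norm x \<le> CB"
    by blast
  have "AE z in surface_measure B \<Otimes>\<^sub>M surface_measure A.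
      norm (fst z) \<le> max CA CB \<and> norm (snd z) \<le> max CA CB"
  proof (rule AE_pair_surface_measureI)
    show "AE x in surface_measure B. AE x' in surface_measure A.
        norm (fst (x, x')) \<le> max CA CB \<and> norm (snd (x, x')) \<le> max CA CB"
      using C(2)
    proof eventually_elim
      case (elim x)
      show ?case using C(1) by eventually_elim (use elim in auto)
    qed
  qed measurable
  then show thesis by (rule that)
qed

text \<open>Triangles are bounded, so by Cauchy-Schwarz a linear factor is essentially bounded and
  preserves integrability.\<close>

lemma abs_integrable_over_mult_inner:
  assumes K: "abs_integrable_over K A B"
  shows abs_integrable_over_inner_rcv: "abs_integrable_over (\<lambda>x x'. of_real (p \<bullet> x) * K x x') A B"
    and abs_integrable_over_inner_src: "abs_integrable_over (\<lambda>x x'. of_real (p \<bullet> x') * K x x') A B"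
proof -
  let ?Q = "surface_measure B \<Otimes>\<^sub>M surface_measure A"
  obtain C where C: "AE z in ?Q. norm (fst z) \<le> C \<and> norm (snd z) \<le> C"
    by (rule AE_pair_surface_measure_bounded)
  let ?K = "\<lambda>(x, x'). K x x'"
  have int: "integrable (completion ?Q) ?K"
    using K by (simp add: abs_integrable_over_def)
  \<comment> \<open>The alternative in the bound treats factors in the receiver and in the source
    variable at once.\<close>
  have int': "integrable (completion ?Q) (\<lambda>z. complex_of_real (w z) * ?K z)"
    if w: "w \<in> borel_measurable (borel \<Otimes>\<^sub>M borel)"
      and bound: "\<And>z. \<bar>w z\<bar> \<le> norm p * norm (fst z) \<or> \<bar>w z\<bar> \<le> norm p * norm (snd z)" for w
  proof (rule Bochner_Integration.integrable_bound)
    show "integrable (completion ?Q) (\<lambda>z. of_real (norm p * C) * ?K z)"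
      using int by (rule integrable_mult_right)
    have [measurable]: "w \<in> borel_measurable (completion ?Q)"
      using w by (intro measurable_completion) (simp add: measurable_cong_sets[OF sets_pair_surface_measure refl])
    have "(\<lambda>z. complex_of_real (w z)) \<in> borel_measurable (completion ?Q)"
      by measurable
    then show "(\<lambda>z. complex_of_real (w z) * ?K z) \<in> borel_measurable (completion ?Q)"
      using borel_measurable_integrable[OF int] by (rule borel_measurable_times)
    show "AE z in completion ?Q. norm (complex_of_real (w z) * ?K z) \<le> norm (of_real (norm p * C) * ?K z)"
      using AE_completion[OF C]
    proof eventually_elim
      case (elim z)
      then have "norm p * norm (fst z) \<le> norm p * C" "norm p * norm (snd z) \<le> norm p * C"
        by (auto intro: mult_left_mono)
      with bound[of z] have "\<bar>w z\<bar> \<le> \<bar>norm p * C\<bar>" by linarith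
      then show ?case
        unfolding norm_mult by (intro mult_right_mono) (simp_all add: norm_mult abs_mult)
    qed
  qed
  show "abs_integrable_over (\<lambda>x x'. of_real (p \<bullet> x) * K x x') A B"
    using int'[of "\<lambda>z. p \<bullet> fst z", OF _ disjI1[OF Cauchy_Schwarz_ineq2]]
    by (simp add: abs_integrable_over_def case_prod_beta')
  show "abs_integrable_over (\<lambda>x x'. of_real (p \<bullet> x') * K x x') A B"
    using int'[of "\<lambda>z. p \<bullet> snd z", OF _ disjI2[OF Cauchy_Schwarz_ineq2]]
    by (simp add: abs_integrable_over_def case_prod_beta')
qed

lemma tri_integral_cong_AE:
  assumes "abs_integrable_over K A B" "abs_integrable_over L A B"
    and "AE z in surface_measure B \<Otimes>\<^sub>M surface_measure A. K (fst z) (snd z) = L (fst z) (snd z)"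
  shows "tri_integral K A B = tri_integral L A B"
  using assms unfolding tri_integral_eq[OF assms(1)] tri_integral_eq[OF assms(2)]
  by (intro integral_cong_AE AE_completion) (auto simp: abs_integrable_over_def case_prod_beta')

lemma tri_integral_add:
  assumes "abs_integrable_over K A B" "abs_integrable_over L A B"
  shows "abs_integrable_over (\<lambda>x x'. K x x' + L x x') A B \<and>
    tri_integral (\<lambda>x x'. K x x' + L x x') A B = tri_integral K A B + tri_integral L A B"
proof -
  have "abs_integrable_over (\<lambda>x x'. K x x' + L x x') A B"
    using assms by (simp add: abs_integrable_over_def case_prod_beta')
  with assms show ?thesis
    by (simp add: tri_integral_eq) (simp add: abs_integrable_over_def case_prod_beta')
qed

lemma tri_integral_mult:
  assumes "abs_integrable_over K A B"
  shows "abs_integrable_over (\<lambda>x x'. a * K x x') A B \<and>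
    tri_integral (\<lambda>x x'. a * K x x') A B = a * tri_integral K A B"
proof -
  have "abs_integrable_over (\<lambda>x x'. a * K x x') A B"
    using assms by (simp add: abs_integrable_over_def case_prod_beta')
  with assms show ?thesis
    by (simp add: tri_integral_eq) (simp add: abs_integrable_over_def case_prod_beta')
qed

text \<open>Homogeneity says nothing about \<open>F 0\<close>, so the kernels are compared off the diagonal only.\<close>

lemma tri_integral_touching_pair:
  fixes F :: "real^3 \<Rightarrow> complex"
  assumes homogeneous: "\<And>r. r \<noteq> 0 \<Longrightarrow> F ((1/2) *\<^sub>R r) = \<sigma> * F r"
    and F: "abs_integrable_over (\<lambda>x x'. F (x - x')) A B"
    and A': "\<And>g :: real^3 \<Rightarrow> ennreal. g \<in> borel_measurable borel \<Longrightarrow>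
      (\<integral>\<^sup>+x. g x \<partial>surface_measure A') = ennreal (1/4) * (\<integral>\<^sup>+x. g (midpoint c x) \<partial>surface_measure A)"
    and B': "\<And>g :: real^3 \<Rightarrow> ennreal. g \<in> borel_measurable borel \<Longrightarrow>
      (\<integral>\<^sup>+x. g x \<partial>surface_measure B') = ennreal (1/4) * (\<integral>\<^sup>+x. g (midpoint c x) \<partial>surface_measure B)"
    and K: "abs_integrable_over
      (\<lambda>x x'. of_real (\<alpha> + p' \<bullet> x') * of_real (\<beta> + p \<bullet> x) * F (x - x')) A' B'"
  shows "tri_integral (\<lambda>x x'. of_real (\<alpha> + p' \<bullet> x') * of_real (\<beta> + p \<bullet> x) * F (x - x')) A' B' =
    1/16 * \<sigma> * (of_real (\<alpha> + p' \<bullet> c / 2) * of_real (\<beta> + p \<bullet> c / 2) * I_one F A B +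
      of_real (\<beta> + p \<bullet> c / 2) / 2 * I_src F p' A B +
      of_real (\<alpha> + p' \<bullet> c / 2) / 2 * I_rcv F p A B + 1/4 * I_both F p' p A B)"
proof -
  let ?K = "\<lambda>x x'. of_real (\<alpha> + p' \<bullet> x') * of_real (\<beta> + p \<bullet> x) * F (x - x')"
  let ?a = "complex_of_real (\<alpha> + p' \<bullet> c / 2)" and ?b = "complex_of_real (\<beta> + p \<bullet> c / 2)"
  let ?s = "\<lambda>x x'. of_real (p' \<bullet> x') * F (x - x')" and ?r = "\<lambda>x x'. of_real (p \<bullet> x) * F (x - x')"
  let ?sr = "\<lambda>x x'. of_real (p' \<bullet> x') * of_real (p \<bullet> x) * F (x - x')"
  \<comment> \<open>At the midpoint of \<open>c\<close> and \<open>x'\<close> the source factor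
    becomes \<open>(\<alpha> + p' \<bullet> c / 2) + p' \<bullet> x' / 2\<close>, and similarly for
    the receiver; \<open>?L\<close> is the product multiplied out.\<close>
  let ?L = "\<lambda>x x'. \<sigma> * (?a * ?b * F (x - x') + ?b / 2 * ?s x x' + ?a / 2 * ?r x x' + 1/4 * ?sr x x')"
  have sr: "abs_integrable_over ?sr A B"
    using abs_integrable_over_inner_src[OF abs_integrable_over_inner_rcv[OF F], of p' p]
    by (simp add: mult.assoc)
  note terms =
    tri_integral_mult[OF F, of "?a * ?b"]
    tri_integral_mult[OF abs_integrable_over_inner_src[OF F, of p'], of "?b / 2"]
    tri_integral_mult[OF abs_integrable_over_inner_rcv[OF F, of p], of "?a / 2"]
    tri_integral_mult[OF sr, of "1/4"]
  note sum2 = tri_integral_add[OF terms(1,2)[THEN conjunct1]]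
  note sum3 = tri_integral_add[OF sum2[THEN conjunct1] terms(3)[THEN conjunct1]]
  note sum4 = tri_integral_add[OF sum3[THEN conjunct1] terms(4)[THEN conjunct1]]
  note L = tri_integral_mult[OF sum4[THEN conjunct1], of \<sigma>]
  have intL: "tri_integral ?L A B =
      \<sigma> * (?a * ?b * I_one F A B + ?b / 2 * I_src F p' A B + ?a / 2 * I_rcv F p A B + 1/4 * I_both F p' p A B)"
    unfolding I_one_def I_src_def I_rcv_def I_both_def
      L[THEN conjunct2] sum4[THEN conjunct2] sum3[THEN conjunct2] sum2[THEN conjunct2]
      terms[THEN conjunct2] ..
  have hom: "abs_integrable_over (\<lambda>x x'. ?K (midpoint c x) (midpoint c x')) A B"
    "tri_integral ?K A' B' = 1/16 * tri_integral (\<lambda>x x'. ?K (midpoint c x) (midpoint c x')) A B"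
    using A' B' K tri_integral_homothety[of A' A c B' B ?K] by blast+
  have "?K (midpoint c x) (midpoint c x') = ?L x x'" if "x \<noteq> x'" for x x'
  proof -
    have "midpoint c x - midpoint c x' = (1/2) *\<^sub>R (x - x')"
      by (simp add: midpoint_def vec_eq_iff field_simps)
    with that homogeneous[of "x - x'"] have "F (midpoint c x - midpoint c x') = \<sigma> * F (x - x')"
      by simp
    moreover have "complex_of_real (\<alpha> + p' \<bullet> midpoint c x') = ?a + of_real (p' \<bullet> x') / 2"
      "complex_of_real (\<beta> + p \<bullet> midpoint c x) = ?b + of_real (p \<bullet> x) / 2"
      by (simp_all add: midpoint_def inner_right_distrib add_divide_distrib)
    moreover have "(a + X / 2) * (b + Y / 2) * (\<sigma> * f) =
        \<sigma> * (a * b * f + b / 2 * (X * f) + a / 2 * (Y * f) + 1/4 * (X * Y * f))"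
      for a b X Y f :: complex
      by (simp add: field_simps)
    ultimately show ?thesis
      by (simp only:)
  qed
  then have "AE z in surface_measure B \<Otimes>\<^sub>M surface_measure A.
      ?K (midpoint c (fst z)) (midpoint c (snd z)) = ?L (fst z) (snd z)"
    by (rule eventually_mono[OF AE_pair_surface_measure_neq])
  from tri_integral_cong_AE[OF hom(1) L[THEN conjunct1] this] show ?thesis
    unfolding hom(2) intL by simp
qed

section \<open>Adding the two touching pairs and solving for the integrals\<close>

theorem mainTheorem3:
  fixes F :: "real^3 \<Rightarrow> complex" and s :: "real \<Rightarrow> complex"
    and S R :: triangle
    and p1 p2 p3 q1 q2 q3 p p' :: "real^3"
  assumes homogeneous: "\<And>\<alpha> r. \<alpha> \<noteq> 0 \<Longrightarrow> r \<noteq> 0 \<Longrightarrow> F (\<alpha> *\<^sub>R r) = s \<alpha> * F r"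
    and S: "S = (p1, p2, p3)" and R: "R = (q1, q2, q3)"
    and "nondegenerate S" and "nondegenerate R"
    and common_edge: "tri_set S \<inter> tri_set R = closed_segment p2 p3"
    and "p2 = q3" and "p3 = q2" and "p2 + p3 = 0"
    and "abs_integrable_over (\<lambda>x x'. F (x - x')) S R"
  shows
    "(1 - (1/8) * s (1/2) \<noteq> 0 \<longrightarrow>
        I_one F S R
          = inverse (1 - (1/8) * s (1/2)) * two_touch_remainder (I_one F) S R)
   \<and> (1 - (1/16) * s (1/2) \<noteq> 0 \<longrightarrow>
        I_src F p' S R
          = inverse (1 - (1/16) * s (1/2)) * two_touch_remainder (I_src F p') S R)
   \<and> (1 - (1/16) * s (1/2) \<noteq> 0 \<longrightarrow>
        I_rcv F p S R
          = inverse (1 - (1/16) * s (1/2)) * two_touch_remainder (I_rcv F p) S R)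
   \<and> (1 - (1/32) * s (1/2) \<noteq> 0 \<longrightarrow>
        I_both F p' p S R
          = inverse (1 - (1/32) * s (1/2)) *
              (two_touch_remainder (I_both F p' p) S R
               + (1/64) * s (1/2)
                   * of_real ((p \<bullet> p2) * (p' \<bullet> p2) + (p \<bullet> p3) * (p' \<bullet> p3))
                   * I_one F S R))"
proof -
  let ?\<sigma> = "s (1/2)"
  have hom: "\<And>r. r \<noteq> 0 \<Longrightarrow> F ((1/2) *\<^sub>R r) = ?\<sigma> * F r"
    using homogeneous[of "1/2"] by simp
  have F: "abs_integrable_over (\<lambda>x x'. F (x - x')) S R" by fact
  have p3: "p3 = - p2"
    using \<open>p2 + p3 = 0\<close> by (simp add: add_eq_0_iff)
  \<comment> \<open>In this form \<open>sub3 R\<close> is visibly the corner at \<open>p2\<close>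
    and \<open>sub2 R\<close> the corner at \<open>p3\<close>, so each touching pair has a common
    centre.\<close>
  have R': "R = (q1, p3, p2)"
    using R \<open>p2 = q3\<close> \<open>p3 = q2\<close> by simp
  \<comment> \<open>Each coefficient is twice 1/16, times one factor 1/2 for every linear factor
    retained: 1/8, 1/16, 1/32. The product of the two shifts is even in the centre, survives the
    cancellation, and contributes the quarter in the first term.\<close>
  have split: "tri_integral (\<lambda>x x'. of_real (\<alpha> + d' \<bullet> x') * of_real (\<beta> + d \<bullet> x) * F (x - x')) S R =
      two_touch_remainder
        (tri_integral (\<lambda>x x'. of_real (\<alpha> + d' \<bullet> x') * of_real (\<beta> + d \<bullet> x) * F (x - x'))) S R +
      (1/8 * ?\<sigma> * of_real (\<alpha> * \<beta> + (d' \<bullet> p2) * (d \<bullet> p2) / 4) * I_one F S R +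
        1/16 * ?\<sigma> * of_real \<beta> * I_src F d' S R + 1/16 * ?\<sigma> * of_real \<alpha> * I_rcv F d S R +
        1/32 * ?\<sigma> * I_both F d' d S R)" for \<alpha> \<beta> d' d
  proof -
    let ?K = "\<lambda>x x'. of_real (\<alpha> + d' \<bullet> x') * of_real (\<beta> + d \<bullet> x) * F (x - x')"
    \<comment> \<open>Expanded form of the kernel, built from sums, constant multiples and linear
      factors alone.\<close>
    have "abs_integrable_over (\<lambda>x x'. of_real \<alpha> * (of_real \<beta> * F (x - x')) +
        of_real \<alpha> * (of_real (d \<bullet> x) * F (x - x')) +
        of_real \<beta> * (of_real (d' \<bullet> x') * F (x - x')) +
        of_real (d' \<bullet> x') * (of_real (d \<bullet> x) * F (x - x'))) S R"
      by (intro tri_integral_add[THEN conjunct1] tri_integral_mult[THEN conjunct1]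
          abs_integrable_over_inner_src abs_integrable_over_inner_rcv F)
    then have K: "abs_integrable_over ?K S R"
      by (simp add: algebra_simps)
    have touch2: "tri_integral ?K (sub2 S) (sub3 R) =
        1/16 * ?\<sigma> * (of_real (\<alpha> + d' \<bullet> p2 / 2) * of_real (\<beta> + d \<bullet> p2 / 2) * I_one F S R +
          of_real (\<beta> + d \<bullet> p2 / 2) / 2 * I_src F d' S R +
          of_real (\<alpha> + d' \<bullet> p2 / 2) / 2 * I_rcv F d S R + 1/4 * I_both F d' d S R)"
      using tri_integral_two_touch(1)[OF K] unfolding S R'
      by (intro tri_integral_touching_pair hom F[unfolded S R'] nn_integral_surface_measure_sub2
          nn_integral_surface_measure_sub3) auto
    have touch3: "tri_integral ?K (sub3 S) (sub2 R) =
        1/16 * ?\<sigma> * (of_real (\<alpha> + d' \<bullet> p3 / 2) * of_real (\<beta> + d \<bullet> p3 / 2) * I_one F S R +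
          of_real (\<beta> + d \<bullet> p3 / 2) / 2 * I_src F d' S R +
          of_real (\<alpha> + d' \<bullet> p3 / 2) / 2 * I_rcv F d S R + 1/4 * I_both F d' d S R)"
      using tri_integral_two_touch(2)[OF K] unfolding S R'
      by (intro tri_integral_touching_pair hom F[unfolded S R'] nn_integral_surface_measure_sub2
          nn_integral_surface_measure_sub3) auto
    show ?thesis
      unfolding tri_integral_two_touch(3)[OF K] touch2 touch3
      by (simp add: p3) (simp add: field_simps)
  qed
  have zero: "I_src F 0 S R = 0" "I_rcv F 0 S R = 0" "I_both F 0 d S R = 0" "I_both F d 0 S R = 0" for d
    by (simp_all add: I_src_def I_rcv_def I_both_def tri_integral_def)
  \<comment> \<open>A constant 1 with zero vector switches a linear factor off; a constant 0 leaves
    it purely linear.\<close>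
  have one: "I_one F S R = two_touch_remainder (I_one F) S R + 1/8 * ?\<sigma> * I_one F S R"
    using split[of 1 0 1 0] by (simp add: zero I_one_def[abs_def])
  have src: "I_src F p' S R = two_touch_remainder (I_src F p') S R + 1/16 * ?\<sigma> * I_src F p' S R"
    using split[of 0 p' 1 0] by (simp add: zero I_src_def[abs_def])
  have rcv: "I_rcv F p S R = two_touch_remainder (I_rcv F p) S R + 1/16 * ?\<sigma> * I_rcv F p S R"
    using split[of 1 0 0 p] by (simp add: zero I_rcv_def[abs_def])
  \<comment> \<open>The middle term is the correction of the theorem: as \<open>p3 = - p2\<close>,
    the products at \<open>p2\<close> and \<open>p3\<close> coincide, and 1/64 of their sum is 1/32
    of one of them.\<close>
  have both: "I_both F p' p S R = two_touch_remainder (I_both F p' p) S R +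
      1/32 * ?\<sigma> * of_real ((p' \<bullet> p2) * (p \<bullet> p2)) * I_one F S R + 1/32 * ?\<sigma> * I_both F p' p S R"
    using split[of 0 p' 0 p] by (simp add: zero I_both_def[abs_def] add.assoc)
  have solve: "X = inverse (1 - k) * Y" if "1 - k \<noteq> 0" "X = Y + k * X" for X Y k :: complex
  proof -
    have "(1 - k) * X = Y" unfolding left_diff_distrib mult_1_left diff_eq_eq by (rule that(2))
    with that(1) show ?thesis by (auto simp: mult.assoc[symmetric])
  qed
  show ?thesis
    using one src rcv both by (intro conjI impI solve) (simp_all add: p3 mult_ac)
qed

end
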